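(* Let $f:\mathbb{R}^N\to\mathbb{R}$ be continuously differentiable and bounded below by a constant $f_{\rm low}$, and let its gradient be block Lipschitz continuous with respect to the partition $\{1,\dots,N\}=\bigcup_{\ell=1}^d b_\ell$ with block constants $L_\ell\ge0$. Let the box-constrained bAdag algorithm with parameter $\varsigma\in(0,1)$ and starting point $x_0\in C$ be applied to $\min_{x\in C}f(x)$, where $C=\{x\in\mathbb{R}^N: a_i\le x_i\le u_i,\ i=1,\dots,N\}$ and $a_i,u_i\in\mathbb{R}\cup\{-\infty,\infty\}$. Put $\Gamma_0=f(x_0)-f_{\rm low}$, $\bar L=\max_{\ell=1,\dots,d}L_\ell$ and $$\Theta_c=\frac{2(\Gamma_0+\varsigma^{3/2})}{\varsigma}+\frac{2N\bar L}{\varsigma}\left[\log\left(\frac{2N\bar L}{\varsigma^{3/2}}\right)-1\right].$$ For each $j$ let $v_j=P_C(x_j-g_j)-x_j$. Then: (GS) with the (box-constrained) Gauss-Southwell rule, for all $k\ge0$, $$\frac1{k+1}\sum_{j=0}^k\|v_j\|\le\sqrt d\,\frac{\Theta_c}{\sqrt{k+1}};$$ (C) with the cyclic rule, if in addition the gradient is globally Lipschitz continuous with constant $L\ge0$, i.e. $\|g(x)-g(y)\|\le L\|x-y\|$ for all $x,y\in\mathbb{R}^N$, then for all $T\ge0$, $$\frac1{T+1}\sum_{t=0}^T\|v_{td}\|\le\sqrt{2\left(1+d\frac{6+4L^2}{\varsigma^2}\right)}\,\frac{\Theta_c}{\sqrt{T+1}};$$ (UR) with uniformly random block selection, for all $k\ge0$,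 $$\mathbb{E}\left[\frac1{k+1}\sum_{j=0}^k\|v_j\|\right]\le d\,\frac{\Theta_c}{\sqrt{k+1}}.$$
   Context: Notation. $\{1,\dots,N\}=\bigcup_{\ell=1}^d b_\ell$ is a fixed partition into $d$ (nonempty, pairwise disjoint) blocks. $g=\nabla f$, $g_k=g(x_k)$, and $g_{i,k}$ is its $i$-th component. For a vector $u\in\mathbb{R}^N$, $u^{(\ell)}$ is the vector equal to $u$ on the components in $b_\ell$ and zero elsewhere. $\|\cdot\|$ is the Euclidean norm; $\log$ is the natural logarithm, with the convention $0\log 0=0$. $P_C$ is the Euclidean projection onto $C$: $[P_C(x)]_i=P_{[a_i,u_i]}(x_i)=\max(a_i,\min(u_i,x_i))$. Block Lipschitz continuity: for every $\ell=1,\dots,d$, $\|g^{(\ell)}(x)-g^{(\ell)}(x+s^{(\ell)})\|\le L_\ell\|s^{(\ell)}\|$ for all $x\in\mathbb{R}^N$ and all $s^{(\ell)}\in\mathbb{R}^N$ with support contained in $b_\ell$. Box-constrained bAdag algorithm. Given $x_0\in C$, $\varsigma\in(0,1)$, and $\eta_{i,-1}=\sqrt{\varsigma}$ for $i=1,\dots,N$. For $k=0,1,2,\dots$: select a block $b_{\ell_k}$; with $v_{i,k}=P_{[a_i,u_i]}(x_{i,k}-g_{i,k})-x_{i,k}$, set $\eta_{i,k}=\sqrt{\eta_{i,k-1}^2+v_{i,k}^2}$ for $i\in b_{\ell_k}$ and $\eta_{i,k}=\eta_{i,k-1}$ otherwise; set $s_{i,k}=v_{i,k}/\max(1,\eta_{i,k})$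 for $i\in b_{\ell_k}$ and $s_{i,k}=0$ otherwise; set $x_{k+1}=x_k+s_k$. (Only the components $v_{i,k}$ with $i\in b_{\ell_k}$ enter the update; $v_k$ in the claim denotes the full vector $P_C(x_k-g_k)-x_k$.) Block selection rules. GS (Gauss-Southwell, box-constrained version): $\ell_k$ is such that $\|v_k^{(\ell_k)}\|=\max_{\ell=1,\dots,d}\|v_k^{(\ell)}\|$. C (cyclic): blocks are picked in cyclic order, so every $d$ iterations each block is updated exactly once, i.e. $\ell_k=(k\bmod d)+1$; $t$ and $T$ count full cycles of $d$ iterations. UR: $\ell_k$ is drawn uniformly from $\{1,\dots,d\}$, independently of the past; $\mathbb{E}$ is the expectation over all block choices ($x_0$ is deterministic). *)

theory Defs
  imports "HOL-Analysis.Analysis" "HOL-Probability.Probability"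
begin

definition feasible_box :: "ereal ^ 'n \<Rightarrow> ereal ^ 'n \<Rightarrow> (real ^ 'n::finite) set" where
  "feasible_box a u = {x. \<forall>i. a $ i \<le> ereal (x $ i) \<and> ereal (x $ i) \<le> u $ i}"

text \<open>\<open>clip lo up\<close> is the projection onto the interval of reals between \<open>lo\<close> and \<open>up\<close>, provided
  that interval is nonempty; the argument of \<open>real_of_ereal\<close> is then always finite. It is used
  only in this situation, since the starting point is feasible.\<close>
definition clip :: "ereal \<Rightarrow> ereal \<Rightarrow> real \<Rightarrow> real" where
  "clip lo up y = real_of_ereal (max lo (min up (ereal y)))"

definition proj_box :: "ereal ^ 'n \<Rightarrow> ereal ^ 'n \<Rightarrow> real ^ 'n \<Rightarrow> real ^ 'n::finite" where
  "proj_box a u y = closest_point (feasible_box a u) y"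

lemma clip_between:
  assumes "lo \<le> ereal z" "ereal z \<le> up"
  shows "lo \<le> ereal (clip lo up y)" "ereal (clip lo up y) \<le> up"
    and "ereal (clip lo up y) = max lo (min up (ereal y))"
proof -
  define p where "p = max lo (min up (ereal y))"
  have "lo \<le> ereal (max z y)"
    using assms(1) by (rule order_trans) simp
  moreover have "min up (ereal y) \<le> ereal (max z y)"
    by (rule min.coboundedI2) simp
  ultimately have "p \<le> ereal (max z y)"
    unfolding p_def by (rule max.boundedI)
  moreover have "ereal (min z y) \<le> min up (ereal y)"
    using order_trans[OF _ assms(2), of "ereal (min z y)"] by (intro min.boundedI) simp_all
  then have "ereal (min z y) \<le> p"
    unfolding p_def by (rule max.coboundedI2)
  ultimately have "p \<le> ereal (max z y)" "ereal (min z y) \<le> p" .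
  then have "ereal (real_of_ereal p) = p"
    by (cases p) (auto simp: max_def min_def split: if_splits)
  then show eq: "ereal (clip lo up y) = max lo (min up (ereal y))"
    unfolding clip_def p_def .
  have "lo \<le> up" using assms by (rule order_trans)
  then show "lo \<le> ereal (clip lo up y)" "ereal (clip lo up y) \<le> up"
    unfolding eq by (simp_all)
qed

lemma clip_closest:
  assumes "lo \<le> ereal z" "ereal z \<le> up"
  shows "\<bar>y - clip lo up y\<bar> \<le> \<bar>y - z\<bar>"
proof -
  define c where "c = clip lo up y"
  have c: "ereal c = max lo (min up (ereal y))"
    unfolding c_def by (rule clip_between(3)[OF assms])
  have "c = y \<or> (y \<le> c \<and> c \<le> z) \<or> (c \<le> y \<and> z \<le> c)"
  proof (cases "lo \<le> min up (ereal y)")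
    case True
    then have c': "ereal c = min up (ereal y)" using c by (simp add: max_def)
    show ?thesis
    proof (cases "up \<le> ereal y")
      case True
      then have "ereal c = up" using c' by (simp add: min_def)
      then show ?thesis using True assms by auto
    next
      case False
      then have "ereal c = ereal y" using c' by (simp add: min_def)
      then show ?thesis by simp
    qed
  next
    case False
    then have cl: "ereal c = lo" using c by (simp only: max_def if_False)
    have "\<not> lo \<le> ereal y" using False order_trans[OF assms] by simp
    then have "ereal y \<le> ereal c" "ereal c \<le> ereal z" using assms cl by auto
    then show ?thesis by simp
  qed
  then show ?thesis unfolding c_def[symmetric] by auto
qed

lemma closed_feasible_box:
  fixes a u :: "ereal ^ 'n::finite"
  shows "closed (feasible_box a u)"
proof -
  have "feasible_box a u = (\<Inter>i. {x. a $ i \<le> ereal (x $ i)} \<inter> {x. ereal (x $ i) \<le> u $ i})"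
    by (auto simp: feasible_box_def)
  moreover have "closed {x::real^'n. a $ i \<le> ereal (x $ i)}" for i
    by (intro closed_Collect_le continuous_intros)
  moreover have "closed {x::real^'n. ereal (x $ i) \<le> u $ i}" for i
    by (intro closed_Collect_le continuous_intros)
  ultimately show ?thesis by (simp add: closed_INT closed_Int)
qed

lemma convex_feasible_box:
  fixes a u :: "ereal ^ 'n::finite"
  shows "convex (feasible_box a u)"
proof -
  have "convex {x::real^'n. a $ i \<le> ereal (x $ i)}" for i
  proof (cases "a $ i")
    case (real r)
    then show ?thesis
      using convex_halfspace_ge[of r "axis i (1::real)"] by (simp add: inner_axis' )
  qed auto
  moreover have "convex {x::real^'n. ereal (x $ i) \<le> u $ i}" for i
  proof (cases "u $ i")
    case (real r)
    then show ?thesis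
      using convex_halfspace_le[of "axis i (1::real)" r] by (simp add: inner_axis' )
  qed auto
  moreover have "feasible_box a u = (\<Inter>i. {x. a $ i \<le> ereal (x $ i)} \<inter> {x. ereal (x $ i) \<le> u $ i})"
    by (auto simp: feasible_box_def)
  ultimately show ?thesis by (simp add: convex_INT convex_Int)
qed

lemma proj_box_nth:
  assumes "feasible_box a u \<noteq> {}"
  shows "proj_box a u y $ i = clip (a $ i) (u $ i) (y $ i)"
proof -
  obtain w where w: "w \<in> feasible_box a u" using assms by blast
  define p where "p = (\<chi> i. clip (a $ i) (u $ i) (y $ i))"
  have w': "a $ i \<le> ereal (w $ i)" "ereal (w $ i) \<le> u $ i" for i
    using w by (simp_all add: feasible_box_def)
  have "p \<in> feasible_box a u"
    using clip_between(1,2)[OF w'] by (simp add: feasible_box_def p_def)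
  moreover have "dist y p \<le> dist y z" if "z \<in> feasible_box a u" for z
  proof -
    have z: "a $ i \<le> ereal (z $ i)" "ereal (z $ i) \<le> u $ i" for i
      using that by (simp_all add: feasible_box_def)
    have "norm ((y - p) $ i) \<le> norm ((y - z) $ i)" for i
      using clip_closest[OF z] by (simp add: p_def)
    then show ?thesis
      unfolding dist_norm norm_vec_def by (intro L2_set_mono) simp_all
  qed
  ultimately have "p = closest_point (feasible_box a u) y"
    by (intro closest_point_unique convex_feasible_box closed_feasible_box) blast+
  then have "proj_box a u y = p" by (simp add: proj_box_def)
  then show ?thesis by (simp add: p_def)
qed

definition block_part :: "'n set \<Rightarrow> real ^ 'n \<Rightarrow> real ^ 'n::finite" where
  "block_part B w = (\<chi> i. if i \<in> B then w $ i else 0)"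

definition block_partition :: "nat \<Rightarrow> (nat \<Rightarrow> 'n set) \<Rightarrow> bool" where
  "block_partition d b \<longleftrightarrow>
     (\<forall>l\<in>{1..d}. b l \<noteq> {}) \<and> disjoint_family_on b {1..d} \<and> (\<Union>l\<in>{1..d}. b l) = UNIV"

definition block_lipschitz ::
  "nat \<Rightarrow> (nat \<Rightarrow> 'n set) \<Rightarrow> (nat \<Rightarrow> real) \<Rightarrow> (real ^ 'n \<Rightarrow> real ^ 'n::finite) \<Rightarrow> bool" where
  "block_lipschitz d b Lb g \<longleftrightarrow>
     (\<forall>l\<in>{1..d}. \<forall>x s. (\<forall>i. i \<notin> b l \<longrightarrow> s $ i = 0) \<longrightarrow>
        norm (block_part (b l) (g x) - block_part (b l) (g (x + s))) \<le> Lb l * norm s)"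

text \<open>One iteration with selected block \<open>B\<close>. A state pairs the iterate \<open>x\<^sub>k\<close> with the weights
  \<open>\<eta>\<^bsub>k-1\<^esub>\<close> of the \<^emph>\<open>previous\<close> iteration; the step divides by the updated weights \<open>\<eta>\<^sub>k\<close>.\<close>
definition badag_step ::
  "ereal ^ 'n \<Rightarrow> ereal ^ 'n \<Rightarrow> (real ^ 'n \<Rightarrow> real ^ 'n) \<Rightarrow> 'n set \<Rightarrow>
    (real ^ 'n) \<times> (real ^ 'n) \<Rightarrow> (real ^ 'n) \<times> (real ^ 'n::finite)" where
  "badag_step a u g B st =
    (let x = fst st;
         v = (\<chi> i. clip (a $ i) (u $ i) (x $ i - g x $ i) - x $ i);
         \<eta> = (\<chi> i. if i \<in> B then sqrt ((snd st $ i)\<^sup>2 + (v $ i)\<^sup>2) else snd st $ i);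
         s = (\<chi> i. if i \<in> B then v $ i / max 1 (\<eta> $ i) else 0)
     in (x + s, \<eta>))"

primrec badag_state ::
  "ereal ^ 'n \<Rightarrow> ereal ^ 'n \<Rightarrow> (real ^ 'n \<Rightarrow> real ^ 'n) \<Rightarrow> (nat \<Rightarrow> 'n set) \<Rightarrow> real \<Rightarrow> real ^ 'n \<Rightarrow>
    (nat \<Rightarrow> nat) \<Rightarrow> nat \<Rightarrow> (real ^ 'n) \<times> (real ^ 'n::finite)" where
  "badag_state a u g b \<sigma> x0 sel 0 = (x0, \<chi> i. sqrt \<sigma>)"
| "badag_state a u g b \<sigma> x0 sel (Suc k) =
     badag_step a u g (b (sel k)) (badag_state a u g b \<sigma> x0 sel k)"

definition badag_iterate ::
  "ereal ^ 'n \<Rightarrow> ereal ^ 'n \<Rightarrow> (real ^ 'n \<Rightarrow> real ^ 'n) \<Rightarrow> (nat \<Rightarrow> 'n set) \<Rightarrow> real \<Rightarrow> real ^ 'n \<Rightarrow>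
    (nat \<Rightarrow> nat) \<Rightarrow> nat \<Rightarrow> real ^ 'n::finite" where
  "badag_iterate a u g b \<sigma> x0 sel k = fst (badag_state a u g b \<sigma> x0 sel k)"

definition badag_v ::
  "ereal ^ 'n \<Rightarrow> ereal ^ 'n \<Rightarrow> (real ^ 'n \<Rightarrow> real ^ 'n) \<Rightarrow> (nat \<Rightarrow> 'n set) \<Rightarrow> real \<Rightarrow> real ^ 'n \<Rightarrow>
    (nat \<Rightarrow> nat) \<Rightarrow> nat \<Rightarrow> real ^ 'n::finite" where
  "badag_v a u g b \<sigma> x0 sel k =
    (let x = badag_iterate a u g b \<sigma> x0 sel k in proj_box a u (x - g x) - x)"

text \<open>In \<open>gauss_southwell\<close> the argument \<open>v\<close> is the sequence of full vectors \<open>v\<^sub>k\<close> generated by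
  the very same selection \<open>sel\<close>; ties in the maximum may be broken arbitrarily.\<close>
definition gauss_southwell ::
  "nat \<Rightarrow> (nat \<Rightarrow> 'n set) \<Rightarrow> (nat \<Rightarrow> real ^ 'n::finite) \<Rightarrow> (nat \<Rightarrow> nat) \<Rightarrow> bool" where
  "gauss_southwell d b v sel \<longleftrightarrow>
     (\<forall>k. sel k \<in> {1..d} \<and>
       norm (block_part (b (sel k)) (v k)) = (MAX l\<in>{1..d}. norm (block_part (b l) (v k))))"

definition cyclic_selection :: "nat \<Rightarrow> nat \<Rightarrow> nat" where
  "cyclic_selection d k = k mod d + 1"

text \<open>\<open>\<xi> k\<close> is the random index \<open>\<ell>\<^sub>k\<close>. Since the starting point is deterministic, independence
  of the past is mutual independence of all draws.\<close>
definition uniform_selection :: "'w measure \<Rightarrow> nat \<Rightarrow> (nat \<Rightarrow> 'w \<Rightarrow> nat) \<Rightarrow> bool" where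
  "uniform_selection M d \<xi> \<longleftrightarrow>
     prob_space M \<and>
     prob_space.indep_vars M (\<lambda>_. count_space UNIV) \<xi> UNIV \<and>
     (\<forall>k. distr M (count_space UNIV) (\<xi> k) = measure_pmf (pmf_of_set {1..d}))"

text \<open>The convention \<open>0 log 0 = 0\<close> is automatic, as the logarithm is multiplied by
  \<open>N * Lbar\<close>.\<close>
definition Theta_c :: "nat \<Rightarrow> real \<Rightarrow> real \<Rightarrow> real \<Rightarrow> real" where
  "Theta_c N Lbar \<Gamma>0 \<sigma> =
     2 * (\<Gamma>0 + \<sigma> powr (3/2)) / \<sigma>
     + 2 * real N * Lbar / \<sigma> * (ln (2 * real N * Lbar / \<sigma> powr (3/2)) - 1)"

end

theory Submission
  imports Defs
begin

text \<open>Let \<open>S\<^sub>K\<close> be the sum over \<open>k < K\<close> of the squared norms of the selected blocks of \<open>v\<^sub>k\<close>, and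
  \<open>W = sqrt (\<sigma> + S\<^sub>K)\<close>. The block descent inequality bounds the accumulated first-order decrease
  \<open>\<Sum> v\<^sup>2 / max 1 \<eta>\<close> by \<open>\<Gamma>\<^sub>0\<close> plus a sum of \<open>(v / \<eta>)\<^sup>2\<close>, which telescopes into logarithms of the
  weights. Since \<open>max 1 \<eta> \<le> W / \<sigma>\<close>, this reads \<open>\<sigma> S\<^sub>K / W \<le> \<Gamma>\<^sub>0 + N Lbar ln (W / sqrt \<sigma>)\<close>, and
  solving for \<open>W\<close> gives \<open>W \<le> \<Theta>\<close> uniformly in \<open>K\<close> and in the selection. Each rule then only
  has to control the full \<open>v\<close> by its selected blocks: by the maximality of the block, by the fact
  that a block does not move before its turn in the cycle, or by independence of the current draw
  from the past.\<close>

subsection \<open>Scalar and Euclidean estimates\<close>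

text \<open>Cauchy-Schwarz turns a bound on the squares that is uniform in \<open>n\<close> into the
  rate \<open>1 / sqrt n\<close>; each selection rule ends with this step. For \<open>n = 0\<close>
  both sides are 0, since division by 0 gives 0.\<close>

lemma mean_le_of_sum_squares_le:
  fixes c :: "nat \<Rightarrow> real"
  assumes sq: "(\<Sum>j<n. (c j)\<^sup>2) \<le> R\<^sup>2" and "0 \<le> R"
  shows "1 / real n * (\<Sum>j<n. c j) \<le> R / sqrt (real n)"
proof (cases "n = 0")
  case False
  have "(\<Sum>j<n. c j)\<^sup>2 \<le> (\<Sum>j<n. (c j)\<^sup>2) * card {..<n}"
    by (rule sum_squared_le_sum_of_squares)
  also have "\<dots> \<le> R\<^sup>2 * n"
    using sq by (simp add: mult_right_mono)
  also have "\<dots> = (R * sqrt n)\<^sup>2" by (simp add: power_mult_distrib)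
  finally have "(\<Sum>j<n. c j) \<le> R * sqrt n"
    by (rule power2_le_imp_le) (simp add: assms)
  then have "1 / real n * (\<Sum>j<n. c j) \<le> R * sqrt n / n"
    by (simp add: divide_right_mono)
  also have "\<dots> = R / sqrt n"
    using False real_sqrt_pow2[of "real n"] by (simp add: frac_eq_eq power2_eq_square)
  finally show ?thesis .
qed simp

text \<open>Splitting \<open>ln (W / c) = ln (W / (2 * B)) + ln (2 * B / c)\<close> and bounding the first term by
  \<open>W / (2 * B) - 1\<close> absorbs half of \<open>W\<close>.\<close>
lemma le_of_le_add_ln:
  fixes W A B c :: real
  assumes W: "W \<le> A + B * ln (W / c)" and "0 < W" "0 < c" "0 \<le> A" "0 \<le> B"
  shows "W \<le> 2 * A + 2 * B * (ln (2 * B / c) - 1)"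
proof (cases "B = 0")
  case False
  then have B: "0 < B" using assms by simp
  have "ln (W / c) = ln (W / (2 * B)) + ln (2 * B / c)"
    using assms B by (simp add: ln_div ln_mult)
  also have "ln (W / (2 * B)) \<le> W / (2 * B) - 1"
    using assms B by (intro ln_le_minus_one) simp
  finally have "B * ln (W / c) \<le> B * (W / (2 * B) - 1 + ln (2 * B / c))"
    using B by simp
  also have "\<dots> = W / 2 + B * (ln (2 * B / c) - 1)"
    using B by (simp add: field_simps)
  finally show ?thesis using W by (simp add: field_simps)
qed (use assms in auto)

text \<open>The Lipschitz condition is required only along the segment and tested against
  \<open>s\<close>, so that block Lipschitz continuity can supply it. The defect \<open>h\<close> of
  the quadratic model then has nonpositive derivative on [0, 1].\<close>

lemma descent_along_segment:
  fixes f :: "'a::real_inner \<Rightarrow> real"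
  assumes grad: "\<And>x. GDERIV f x :> g x"
    and lip: "\<And>t. 0 \<le> t \<Longrightarrow> t \<le> 1 \<Longrightarrow> (g (x + t *\<^sub>R s) - g x) \<bullet> s \<le> L * t * (norm s)\<^sup>2"
  shows "f (x + s) \<le> f x + g x \<bullet> s + L / 2 * (norm s)\<^sup>2"
proof -
  define h where "h t = f (x + t *\<^sub>R s) - t * (g x \<bullet> s) - L * t\<^sup>2 / 2 * (norm s)\<^sup>2" for t
  have "((\<lambda>t. f (x + t *\<^sub>R s)) has_real_derivative g (x + t *\<^sub>R s) \<bullet> s) (at t)" for t
  proof -
    have "((\<lambda>t. x + t *\<^sub>R s) has_derivative (\<lambda>h. h *\<^sub>R s)) (at t)"
      by (auto intro!: derivative_eq_intros)
    from has_derivative_compose[OF this grad[unfolded gderiv_def]]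
    show ?thesis
      by (simp add: has_field_derivative_def inner_commute mult_commute_abs)
  qed
  note this [derivative_intros]
  have "h 1 \<le> h 0"
  proof (rule DERIV_nonpos_imp_nonincreasing[of 0 1 h])
    fix t :: real assume t: "0 \<le> t" "t \<le> 1"
    have "(h has_real_derivative g (x + t *\<^sub>R s) \<bullet> s - g x \<bullet> s - L * t * (norm s)\<^sup>2) (at t)"
      unfolding h_def[abs_def] by (auto intro!: derivative_eq_intros)
    moreover have "g (x + t *\<^sub>R s) \<bullet> s - g x \<bullet> s - L * t * (norm s)\<^sup>2 \<le> 0"
      using lip[OF t] by (simp add: inner_diff_left)
    ultimately show "\<exists>y. (h has_real_derivative y) (at t) \<and> y \<le> 0" by blast
  qed simp
  then show ?thesis by (simp add: h_def)
qed

lemma power2_norm_vec: "(norm (w :: real ^ 'n::finite))\<^sup>2 = (\<Sum>i\<in>UNIV. (w $ i)\<^sup>2)"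
  unfolding power2_norm_eq_inner inner_vec_def by (simp add: power2_eq_square)

lemma power2_norm_block_part: "(norm (block_part B w))\<^sup>2 = (\<Sum>i\<in>B. (w $ i)\<^sup>2)"
  unfolding power2_norm_vec block_part_def
  by (simp add: if_distrib[of "\<lambda>x. x\<^sup>2"] sum.If_cases)

lemma power2_norm_sum_block_part:
  assumes "block_partition d b"
  shows "(norm w)\<^sup>2 = (\<Sum>l\<in>{1..d}. (norm (block_part (b l) w))\<^sup>2)"
proof -
  have "(norm w)\<^sup>2 = (\<Sum>i\<in>(\<Union>l\<in>{1..d}. b l). (w $ i)\<^sup>2)"
    using assms by (simp add: block_partition_def power2_norm_vec)
  also have "\<dots> = (\<Sum>l\<in>{1..d}. \<Sum>i\<in>b l. (w $ i)\<^sup>2)"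
    using assms by (intro sum.UNION_disjoint) (auto simp: block_partition_def disjoint_family_on_def)
  finally show ?thesis by (simp add: power2_norm_block_part)
qed

lemma norm_le_sum_block_part:
  assumes "block_partition d b"
  shows "norm w \<le> (\<Sum>l\<in>{1..d}. norm (block_part (b l) w))"
proof (rule power2_le_imp_le)
  have "sqrt (\<Sum>l\<in>{1..d}. (norm (block_part (b l) w))\<^sup>2) \<le> (\<Sum>l\<in>{1..d}. norm (block_part (b l) w))"
    unfolding L2_set_def[symmetric] by (rule L2_set_le_sum) simp
  then show "(norm w)\<^sup>2 \<le> (\<Sum>l\<in>{1..d}. norm (block_part (b l) w))\<^sup>2"
    unfolding power2_norm_sum_block_part[OF assms, of w] by (rule sqrt_le_D)
qed (simp add: sum_nonneg)

lemma block_partition_pos: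
  fixes b :: "nat \<Rightarrow> 'n::finite set"
  assumes "block_partition d b"
  shows "1 \<le> d"
  using assms by (cases d) (auto simp: block_partition_def)

subsection \<open>Projection onto an interval\<close>

text \<open>Clipping composes a \<open>min\<close> and a \<open>max\<close> with fixed bounds, each
  1-Lipschitz; an infinite bound just drops its factor. The point \<open>z\<close> witnesses that
  the interval is nonempty.\<close>

lemma clip_nonexpansive:
  assumes "lo \<le> ereal z" "ereal z \<le> up"
  shows "\<bar>clip lo up x - clip lo up y\<bar> \<le> \<bar>x - y\<bar>"
proof -
  define c e where "c = clip lo up x" "e = clip lo up y"
  have ce: "ereal c = max lo (min up (ereal x))" "ereal e = max lo (min up (ereal y))"
    unfolding c_e_def by (rule clip_between(3)[OF assms])+
  have m1: "\<bar>max a p - max a q\<bar> \<le> \<bar>p - q\<bar>" and m2: "\<bar>min a p - min a q\<bar> \<le> \<bar>p - q\<bar>" for a p q :: real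
    by (auto simp: max_def min_def)
  have "\<bar>c - e\<bar> \<le> \<bar>x - y\<bar>"
  proof (cases lo)
    case lo: (real r)
    show ?thesis
    proof (cases up)
      case (real s)
      then have "c = max r (min s x)" "e = max r (min s y)" 
        using ce lo by (simp_all flip: ereal_min ereal_max)
      then show ?thesis using order_trans[OF m1 m2] by simp
    qed (use assms ce lo m1 in \<open>simp_all flip: ereal_min ereal_max\<close>)
  next
    case lo: MInf
    show ?thesis
      by (cases up) (use assms ce lo m2 in \<open>simp_all flip: ereal_min ereal_max\<close>)
  qed (use assms in simp)
  then show ?thesis by (simp add: c_e_def)
qed

text \<open>This is the variational inequality of the projection, tested at the feasible point
  \<open>x\<close>: the projected point lies between \<open>x\<close> and \<open>x - h\<close>. It
  makes the projected step a descent direction.\<close>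

lemma clip_step_square_le:
  assumes "lo \<le> ereal x" "ereal x \<le> up"
  shows "(clip lo up (x - h) - x)\<^sup>2 \<le> - h * (clip lo up (x - h) - x)"
proof -
  define c where "c = clip lo up (x - h)"
  have "(x - h \<le> c \<and> c \<le> x) \<or> (x \<le> c \<and> c \<le> x - h)"
    using assms unfolding c_def by (cases lo; cases up) (auto simp: clip_def max_def min_def)
  then have "(c - x) * (c - (x - h)) \<le> 0"
    by (auto intro: mult_nonneg_nonpos mult_nonpos_nonneg)
  then show ?thesis
    by (simp add: c_def[symmetric] power2_eq_square algebra_simps)
qed

lemma between_ereal_convex:
  assumes "lo \<le> ereal x" "ereal x \<le> up" "lo \<le> ereal c" "ereal c \<le> up" "0 \<le> t" "t \<le> 1"
  shows "lo \<le> ereal (x + t * (c - x))" "ereal (x + t * (c - x)) \<le> up"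
proof -
  have "min x c \<le> x + t * (c - x) \<and> x + t * (c - x) \<le> max x c"
  proof (cases "x \<le> c")
    case True
    then have "0 \<le> t * (c - x)" "t * (c - x) \<le> c - x"
      using assms(5,6) by (simp_all add: mult_left_le_one_le)
    then show ?thesis using True by simp
  next
    case False
    then have "0 \<le> t * (x - c)" "t * (x - c) \<le> x - c"
      using assms(5,6) by (simp_all add: mult_left_le_one_le)
    then show ?thesis using False by (simp add: right_diff_distrib)
  qed
  moreover have "lo \<le> ereal (min x c)" "ereal (max x c) \<le> up"
    using assms by (auto simp: min_def max_def)
  ultimately show "lo \<le> ereal (x + t * (c - x))" "ereal (x + t * (c - x)) \<le> up"
    by (meson ereal_less_eq(3) order_trans)+
qed

subsection \<open>The iteration\<close>

text \<open>The selection is left as an argument of every fact, so that the bounds hold for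
  arbitrary, rerouted and randomly drawn selections alike.\<close>

locale badag =
  fixes f :: "real ^ 'n::finite \<Rightarrow> real" and g :: "real ^ 'n \<Rightarrow> real ^ 'n"
    and f_low \<sigma> :: real
    and d :: nat and b :: "nat \<Rightarrow> 'n set" and Lb :: "nat \<Rightarrow> real"
    and a u :: "ereal ^ 'n" and x0 :: "real ^ 'n"
  assumes gradient: "\<And>x. GDERIV f x :> g x"
    and bounded_below: "\<And>x. f_low \<le> f x"
    and partition: "block_partition d b"
    and Lb_nonneg: "\<And>l. l \<in> {1..d} \<Longrightarrow> 0 \<le> Lb l"
    and block_lip: "block_lipschitz d b Lb g"
    and sigma: "0 < \<sigma>" "\<sigma> < 1"
    and start: "x0 \<in> feasible_box a u"
begin

abbreviation "iter \<equiv> badag_iterate a u g b \<sigma> x0"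

abbreviation "v \<equiv> badag_v a u g b \<sigma> x0"

text \<open>Like the second component of the state, \<open>eta sel k\<close> is the paper's \<open>\<eta>\<^bsub>k-1\<^esub>\<close>.\<close>
definition eta :: "(nat \<Rightarrow> nat) \<Rightarrow> nat \<Rightarrow> 'n \<Rightarrow> real" where
  "eta sel k i = snd (badag_state a u g b \<sigma> x0 sel k) $ i"

text \<open>Only selected blocks are counted because these are what the weights accumulate: the
  squared weights sum to \<open>N * \<sigma>\<close> plus the energy.\<close>

definition energy :: "(nat \<Rightarrow> nat) \<Rightarrow> nat \<Rightarrow> real" where
  "energy sel k = (\<Sum>j<k. (norm (block_part (b (sel j)) (v sel j)))\<^sup>2)"

definition Lbar :: real where
  "Lbar = (MAX l\<in>{1..d}. Lb l)"

lemma d_pos: "1 \<le> d"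
  by (rule block_partition_pos[OF partition])

lemma Lb_le_Lbar: "l \<in> {1..d} \<Longrightarrow> Lb l \<le> Lbar"
  unfolding Lbar_def by (intro Max_ge) auto

lemma Lbar_nonneg: "0 \<le> Lbar"
  using Lb_nonneg[of 1] Lb_le_Lbar[of 1] d_pos by simp

text \<open>Projection onto a box acts coordinatewise, so the vector defined by the closest point
  agrees with the clipped one inside \<open>badag_step\<close>. The box is nonempty because it
  contains \<open>x0\<close>.\<close>

lemma v_nth:
  "v sel k $ i = clip (a $ i) (u $ i) (iter sel k $ i - g (iter sel k) $ i) - iter sel k $ i"
proof -
  have "feasible_box a u \<noteq> {}" using start by blast
  then show ?thesis by (simp add: badag_v_def Let_def proj_box_nth)
qed

lemma eta_0: "eta sel 0 i = sqrt \<sigma>"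
  by (simp add: eta_def)

lemma eta_Suc:
  "eta sel (Suc k) i =
    (if i \<in> b (sel k) then sqrt ((eta sel k i)\<^sup>2 + (v sel k $ i)\<^sup>2) else eta sel k i)"
  by (simp add: eta_def v_nth badag_step_def Let_def badag_iterate_def)

lemma iter_Suc_nth:
  "iter sel (Suc k) $ i =
    iter sel k $ i + (if i \<in> b (sel k) then v sel k $ i / max 1 (eta sel (Suc k) i) else 0)"
  by (simp add: eta_def v_nth badag_step_def Let_def badag_iterate_def)

lemma eta_pos: "0 < eta sel k i"
proof (induction k)
  case (Suc k)
  then show ?case by (simp add: eta_Suc add_pos_nonneg)
qed (simp add: eta_0 sigma)

lemma power2_eta_Suc:
  "(eta sel (Suc k) i)\<^sup>2 = (eta sel k i)\<^sup>2 + (if i \<in> b (sel k) then (v sel k $ i)\<^sup>2 else 0)"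
  by (simp add: eta_Suc)

lemma power2_eta:
  "(eta sel k i)\<^sup>2 = \<sigma> + (\<Sum>j<k. if i \<in> b (sel j) then (v sel j $ i)\<^sup>2 else 0)"
  using sigma by (induction k) (simp_all add: eta_0 power2_eta_Suc)

lemma power2_eta_le_energy: "(eta sel k i)\<^sup>2 \<le> \<sigma> + energy sel k"
  unfolding power2_eta energy_def power2_norm_block_part
  by (intro add_left_mono sum_mono) (auto intro: member_le_sum sum_nonneg)

lemma energy_nonneg: "0 \<le> energy sel k"
  by (simp add: energy_def sum_nonneg)

lemma energy_add:
  "energy sel (k + m) =
    energy sel k + (\<Sum>q<m. (norm (block_part (b (sel (k + q))) (v sel (k + q))))\<^sup>2)"
  unfolding energy_def by (induction m) simp_all

lemma energy_mono: "j \<le> k \<Longrightarrow> energy sel j \<le> energy sel k"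
  unfolding energy_def by (intro sum_mono2) auto

text \<open>Division by \<open>max 1 \<eta>\<close> makes each new coordinate a convex combination
  of the old one and its clipped gradient step.\<close>

lemma iter_feasible: "iter sel k \<in> feasible_box a u"
proof (induction k)
  case 0
  then show ?case by (simp add: badag_iterate_def start)
next
  case (Suc k)
  define x where "x = iter sel k"
  have x: "a $ i \<le> ereal (x $ i)" "ereal (x $ i) \<le> u $ i" for i
    using Suc by (auto simp: feasible_box_def x_def)
  have "a $ i \<le> ereal (iter sel (Suc k) $ i) \<and> ereal (iter sel (Suc k) $ i) \<le> u $ i" for i
  proof (cases "i \<in> b (sel k)")
    case True
    define c where "c = clip (a $ i) (u $ i) (x $ i - g x $ i)"
    define t where "t = 1 / max 1 (eta sel (Suc k) i)"
    have "iter sel (Suc k) $ i = x $ i + t * (c - x $ i)"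
      using True by (simp add: iter_Suc_nth v_nth x_def c_def t_def)
    moreover have "0 \<le> t" "t \<le> 1"
      by (simp_all add: t_def)
    moreover have "a $ i \<le> ereal c" "ereal c \<le> u $ i"
      unfolding c_def by (rule clip_between[OF x])+
    ultimately show ?thesis
      using between_ereal_convex[OF x[of i], of c t] by simp
  next
    case False
    then show ?thesis using x[of i] by (simp add: iter_Suc_nth x_def)
  qed
  then show ?case by (simp add: feasible_box_def)
qed

lemma power2_v_le: "(v sel k $ i)\<^sup>2 \<le> - g (iter sel k) $ i * v sel k $ i"
  unfolding v_nth using iter_feasible[of sel k]
  by (intro clip_step_square_le) (auto simp: feasible_box_def)

lemma norm_iter_step_le:
  "norm (iter sel (Suc k) - iter sel k) \<le> norm (block_part (b (sel k)) (v sel k))"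
proof (rule power2_le_imp_le)
  have "\<bar>(iter sel (Suc k) - iter sel k) $ i\<bar> \<le> \<bar>block_part (b (sel k)) (v sel k) $ i\<bar>" for i
  proof -
    define m where "m = max 1 (eta sel (Suc k) i)"
    have "1 \<le> m" by (simp add: m_def)
    then have "\<bar>v sel k $ i / m\<bar> \<le> \<bar>v sel k $ i\<bar>"
      using divide_left_mono[of 1 m "\<bar>v sel k $ i\<bar>"] by simp
    then show ?thesis by (simp add: iter_Suc_nth block_part_def m_def)
  qed
  then show "(norm (iter sel (Suc k) - iter sel k))\<^sup>2 \<le> (norm (block_part (b (sel k)) (v sel k)))\<^sup>2"
    unfolding power2_norm_vec by (intro sum_mono) (simp add: abs_le_square_iff)
qed simp

text \<open>The step is supported in the selected block, so its inner product with a gradient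
  difference sees only that block and \<open>Lbar\<close> suffices. The first-order term is
  controlled by \<open>power2_v_le\<close>.\<close>

lemma one_step_descent:
  assumes "sel k \<in> {1..d}"
  shows "f (iter sel (Suc k)) \<le> f (iter sel k)
    - (\<Sum>i\<in>b (sel k). (v sel k $ i)\<^sup>2 / max 1 (eta sel (Suc k) i))
    + Lbar / 2 * (\<Sum>i\<in>b (sel k). (v sel k $ i / max 1 (eta sel (Suc k) i))\<^sup>2)"
proof -
  define B x s where "B = b (sel k)" and "x = iter sel k" and "s = iter sel (Suc k) - iter sel k"
  have s_nth: "s $ i = (if i \<in> B then v sel k $ i / max 1 (eta sel (Suc k) i) else 0)" for i
    by (simp add: s_def iter_Suc_nth B_def)
  have s_block: "w \<bullet> s = block_part B w \<bullet> s" for w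
    unfolding inner_vec_def by (intro sum.cong) (auto simp: s_nth block_part_def)
  have "(g (x + t *\<^sub>R s) - g x) \<bullet> s \<le> Lbar * t * (norm s)\<^sup>2" if "0 \<le> t" for t
  proof -
    have "(g (x + t *\<^sub>R s) - g x) \<bullet> s = (block_part B (g (x + t *\<^sub>R s)) - block_part B (g x)) \<bullet> s"
      by (simp only: inner_diff_left s_block[symmetric])
    also have "\<dots> \<le> norm (block_part B (g (x + t *\<^sub>R s)) - block_part B (g x)) * norm s"
      by (rule norm_cauchy_schwarz)
    also have "norm (block_part B (g (x + t *\<^sub>R s)) - block_part B (g x)) \<le> Lb (sel k) * norm (t *\<^sub>R s)"
      using block_lip assms unfolding block_lipschitz_def B_def[symmetric]
      by (subst norm_minus_commute) (force simp: B_def s_nth simp del: norm_scaleR)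
    also have "\<dots> \<le> Lbar * norm (t *\<^sub>R s)"
      using Lb_le_Lbar[OF assms] by (intro mult_right_mono) auto
    finally show ?thesis
      using that by (simp add: power2_eq_square mult_right_mono mult.assoc)
  qed
  from descent_along_segment[OF gradient this]
  have "f (x + s) \<le> f x + g x \<bullet> s + Lbar / 2 * (norm s)\<^sup>2" by blast
  moreover have "(norm s)\<^sup>2 = (\<Sum>i\<in>B. (v sel k $ i / max 1 (eta sel (Suc k) i))\<^sup>2)"
    by (simp add: power2_norm_vec s_nth if_distrib[of "\<lambda>x. x\<^sup>2"] sum.If_cases)
  moreover have "g x \<bullet> s \<le> - (\<Sum>i\<in>B. (v sel k $ i)\<^sup>2 / max 1 (eta sel (Suc k) i))"
  proof -
    have "g x \<bullet> s = (\<Sum>i\<in>B. g x $ i * (v sel k $ i / max 1 (eta sel (Suc k) i)))"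
      by (simp add: inner_vec_def s_nth if_distrib[of "\<lambda>y. _ * y"] sum.If_cases cong: if_cong)
    also have "\<dots> \<le> (\<Sum>i\<in>B. - ((v sel k $ i)\<^sup>2 / max 1 (eta sel (Suc k) i)))"
    proof (rule sum_mono)
      fix i
      show "g x $ i * (v sel k $ i / max 1 (eta sel (Suc k) i))
          \<le> - ((v sel k $ i)\<^sup>2 / max 1 (eta sel (Suc k) i))"
        using divide_right_mono[OF power2_v_le[of sel k i], of "max 1 (eta sel (Suc k) i)"]
        by (simp add: x_def le_max_iff_disj)
    qed
    finally show ?thesis by (simp add: sum_negf)
  qed
  ultimately show ?thesis by (simp add: x_def s_def B_def)
qed

text \<open>With \<open>p\<close> and \<open>q\<close> the squared weights before and after, the
  left side is at most \<open>(q - p) / q = 1 - p / q\<close>, and \<open>ln x \<le> x - 1\<close>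
  at \<open>x = p / q\<close> makes this telescoping.\<close>

lemma scaled_step_le_ln_eta:
  assumes "i \<in> b (sel k)"
  shows "(v sel k $ i / max 1 (eta sel (Suc k) i))\<^sup>2 \<le> ln ((eta sel (Suc k) i)\<^sup>2) - ln ((eta sel k i)\<^sup>2)"
proof -
  define p q where "p = (eta sel k i)\<^sup>2" and "q = (eta sel (Suc k) i)\<^sup>2"
  have pq: "0 < p" "0 < q"
    unfolding p_def q_def by (intro zero_less_power eta_pos)+
  have v_eq: "(v sel k $ i)\<^sup>2 = q - p"
    using assms by (simp add: p_def q_def power2_eta_Suc)
  have "(v sel k $ i / max 1 (eta sel (Suc k) i))\<^sup>2 \<le> (q - p) / q"
    unfolding power_divide v_eq[symmetric]
    using eta_pos[of sel "Suc k" i] unfolding q_def by (intro divide_left_mono power_mono) auto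
  also have "\<dots> = 1 - p / q" using pq by (simp add: field_simps)
  also have "\<dots> \<le> - ln (p / q)" using ln_le_minus_one[of "p / q"] pq by simp
  also have "\<dots> = ln q - ln p" using pq by (simp add: ln_div)
  finally show ?thesis unfolding p_def q_def .
qed

text \<open>The weights never exceed \<open>W = sqrt (\<sigma> + energy sel K)\<close>, and \<open>\<sigma> < 1 \<le> W / sqrt \<sigma>\<close>, hence
  \<open>max 1 \<eta> \<le> W / \<sigma>\<close>; the logarithms telescope.\<close>
lemma accumulated_descent:
  assumes sel: "\<And>k. k < K \<Longrightarrow> sel k \<in> {1..d}" and "k \<le> K"
  shows "f (iter sel k) \<le> f x0 - \<sigma> / sqrt (\<sigma> + energy sel K) * energy sel k
    + Lbar / 2 * (\<Sum>i\<in>UNIV. ln ((eta sel k i)\<^sup>2) - ln \<sigma>)"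
  using \<open>k \<le> K\<close>
proof (induction k)
  case 0
  then show ?case using sigma by (simp add: badag_iterate_def energy_def eta_0)
next
  case (Suc k)
  \<comment> \<open>\<open>W\<close> is taken at the final time \<open>K\<close>, so the coefficient
    \<open>\<sigma> / W\<close> stays constant during the induction.\<close>
  define W where "W = sqrt (\<sigma> + energy sel K)"
  define B where "B = b (sel k)"
  have W: "sqrt \<sigma> \<le> W" "0 < W"
    using energy_nonneg[of sel K] sigma by (auto simp: W_def)
  have "\<sigma> \<le> sqrt \<sigma>"
    using sigma by (intro real_le_rsqrt) (simp add: power2_eq_square)
  then have "1 \<le> W / \<sigma>" using W sigma by simp
  moreover have "eta sel (Suc k) i \<le> W / \<sigma>" for i
  proof -
    have "eta sel (Suc k) i \<le> W"
      using power2_eta_le_energy[of sel "Suc k" i] energy_mono[OF Suc.prems, of sel]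
      unfolding W_def by (intro real_le_rsqrt) simp
    also have "W \<le> W / \<sigma>" using W sigma by (simp add: field_simps)
    finally show ?thesis .
  qed
  ultimately have "max 1 (eta sel (Suc k) i) \<le> W / \<sigma>" for i by simp
  then have "(v sel k $ i)\<^sup>2 / (W / \<sigma>) \<le> (v sel k $ i)\<^sup>2 / max 1 (eta sel (Suc k) i)" for i
    by (intro divide_left_mono) (auto simp: W sigma)
  then have "(\<Sum>i\<in>B. (v sel k $ i)\<^sup>2 / (W / \<sigma>)) \<le> (\<Sum>i\<in>B. (v sel k $ i)\<^sup>2 / max 1 (eta sel (Suc k) i))"
    by (rule sum_mono)
  moreover have "(\<Sum>i\<in>B. (v sel k $ i)\<^sup>2 / (W / \<sigma>)) = \<sigma> / W * (energy sel (Suc k) - energy sel k)"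
    by (simp add: energy_def power2_norm_block_part B_def sum_distrib_left sum_divide_distrib mult.commute)
  moreover have "Lbar / 2 * (\<Sum>i\<in>B. (v sel k $ i / max 1 (eta sel (Suc k) i))\<^sup>2)
      \<le> Lbar / 2 * (\<Sum>i\<in>UNIV. ln ((eta sel (Suc k) i)\<^sup>2) - ln ((eta sel k i)\<^sup>2))"
  proof (rule mult_left_mono)
    have "(\<Sum>i\<in>B. (v sel k $ i / max 1 (eta sel (Suc k) i))\<^sup>2)
        \<le> (\<Sum>i\<in>B. ln ((eta sel (Suc k) i)\<^sup>2) - ln ((eta sel k i)\<^sup>2))"
      unfolding B_def by (intro sum_mono scaled_step_le_ln_eta)
    \<comment> \<open>Weights outside the selected block do not change, so the extra terms vanish
      and the sum telescopes in every coordinate.\<close>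
    also have "\<dots> = (\<Sum>i\<in>UNIV. ln ((eta sel (Suc k) i)\<^sup>2) - ln ((eta sel k i)\<^sup>2))"
      by (intro sum.mono_neutral_left) (auto simp: B_def eta_Suc)
    finally show "(\<Sum>i\<in>B. (v sel k $ i / max 1 (eta sel (Suc k) i))\<^sup>2)
        \<le> (\<Sum>i\<in>UNIV. ln ((eta sel (Suc k) i)\<^sup>2) - ln ((eta sel k i)\<^sup>2))" .
  qed (simp add: Lbar_nonneg)
  moreover have "(\<Sum>i\<in>UNIV. ln ((eta sel (Suc k) i)\<^sup>2) - ln \<sigma>) = (\<Sum>i\<in>UNIV. ln ((eta sel k i)\<^sup>2) - ln \<sigma>)
      + (\<Sum>i\<in>UNIV. ln ((eta sel (Suc k) i)\<^sup>2) - ln ((eta sel k i)\<^sup>2))"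
    by (simp flip: sum.distrib)
  moreover have "f (iter sel k) \<le> f x0 - \<sigma> / W * energy sel k
      + Lbar / 2 * (\<Sum>i\<in>UNIV. ln ((eta sel k i)\<^sup>2) - ln \<sigma>)"
    using Suc unfolding W_def by simp
  moreover have "sel k \<in> {1..d}" using sel Suc.prems by simp
  then have "f (iter sel (Suc k)) \<le> f (iter sel k)
      - (\<Sum>i\<in>B. (v sel k $ i)\<^sup>2 / max 1 (eta sel (Suc k) i))
      + Lbar / 2 * (\<Sum>i\<in>B. (v sel k $ i / max 1 (eta sel (Suc k) i))\<^sup>2)"
    unfolding B_def by (rule one_step_descent)
  ultimately show ?case
    unfolding W_def[symmetric] by (simp only: distrib_left right_diff_distrib)
qed

section \<open>Uniform bound on the accumulated energy\<close>

abbreviation "\<Theta> \<equiv> Theta_c CARD('n) Lbar (f x0 - f_low) \<sigma>"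

lemma sqrt_energy_le_Theta:
  assumes sel: "\<And>k. k < K \<Longrightarrow> sel k \<in> {1..d}"
  shows "sqrt (\<sigma> + energy sel K) \<le> \<Theta>"
proof -
  define W where "W = sqrt (\<sigma> + energy sel K)"
  define N where "N = real CARD('n)"
  have W: "sqrt \<sigma> \<le> W" "0 < W" "W\<^sup>2 = \<sigma> + energy sel K"
    using energy_nonneg[of sel K] sigma by (auto simp: W_def)
  have pw: "\<sigma> powr (3/2) = \<sigma> * sqrt \<sigma>"
    using sigma powr_add[of \<sigma> 1 "1/2"] by (simp add: powr_half_sqrt)
  \<comment> \<open>Each weight is at most \<open>W\<close>; adding this over all coordinates is the
    source of the factor \<open>N\<close> in \<open>\<Theta>\<close>.\<close>
  have "ln ((eta sel K i)\<^sup>2) - ln \<sigma> \<le> 2 * ln (W / sqrt \<sigma>)" for i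
  proof -
    have "ln ((eta sel K i)\<^sup>2) \<le> ln (W\<^sup>2)"
      using power2_eta_le_energy[of sel K i, folded W(3)] eta_pos[of sel K i] W(2)
      by (simp only: ln_le_cancel_iff[OF zero_less_power zero_less_power])
    then show ?thesis
      using W(2) sigma by (simp add: ln_div ln_realpow ln_sqrt)
  qed
  then have "(\<Sum>i\<in>(UNIV::'n set). ln ((eta sel K i)\<^sup>2) - ln \<sigma>) \<le> (\<Sum>i\<in>(UNIV::'n set). 2 * ln (W / sqrt \<sigma>))"
    by (rule sum_mono)
  then have "Lbar / 2 * (\<Sum>i\<in>UNIV. ln ((eta sel K i)\<^sup>2) - ln \<sigma>) \<le> Lbar / 2 * (2 * N * ln (W / sqrt \<sigma>))"
    using Lbar_nonneg by (intro mult_left_mono) (auto simp: N_def)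
  then have main: "\<sigma> / W * energy sel K \<le> f x0 - f_low + N * Lbar * ln (W / sqrt \<sigma>)"
    using accumulated_descent[of K sel K, folded W_def] sel bounded_below[of "iter sel K"]
    by (simp add: algebra_simps)
  \<comment> \<open>As \<open>energy = W * W - \<sigma>\<close>, the left side of
    \<open>main\<close> equals \<open>\<sigma> * W - \<sigma> * (\<sigma> / W)\<close>. The loss is
    at most \<open>\<sigma> * sqrt \<sigma>\<close>, which is the term
    \<open>\<sigma> powr (3/2)\<close> of \<open>\<Theta>\<close>.\<close>
  have "\<sigma> * W - \<sigma> * sqrt \<sigma> \<le> \<sigma> * W - \<sigma> * (\<sigma> / W)"
  proof -
    have "\<sigma> / W \<le> \<sigma> / sqrt \<sigma>" using W sigma by (intro divide_left_mono) auto
    also have "\<dots> = sqrt \<sigma>" using sigma by (simp add: real_div_sqrt)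
    finally show ?thesis using sigma by (intro diff_left_mono mult_left_mono) auto
  qed
  also have "\<dots> = \<sigma> / W * energy sel K"
  proof -
    have eq: "energy sel K = W * W - \<sigma>" using W(3) by (simp add: power2_eq_square)
    show ?thesis unfolding eq using W(2) by (simp add: field_simps)
  qed
  finally have "\<sigma> * W \<le> (f x0 - f_low + \<sigma> powr (3/2)) + N * Lbar * ln (W / sqrt \<sigma>)"
    using main by (simp add: pw)
  then have "W \<le> (f x0 - f_low + \<sigma> powr (3/2)) / \<sigma> + N * Lbar / \<sigma> * ln (W / sqrt \<sigma>)"
    using sigma by (simp add: field_simps)
  then have "W \<le> 2 * ((f x0 - f_low + \<sigma> powr (3/2)) / \<sigma>)
      + 2 * (N * Lbar / \<sigma>) * (ln (2 * (N * Lbar / \<sigma>) / sqrt \<sigma>) - 1)"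
    by (rule le_of_le_add_ln) (use W sigma bounded_below[of x0] Lbar_nonneg in \<open>auto simp: N_def\<close>)
  also have "2 * (N * Lbar / \<sigma>) / sqrt \<sigma> = 2 * N * Lbar / \<sigma> powr (3/2)"
    by (simp add: pw)
  finally show ?thesis
    by (simp add: Theta_c_def W_def N_def)
qed

text \<open>The formula does not show this, as its logarithm may be negative; the energy bound at
  \<open>K = 0\<close> gives it, its hypothesis then being vacuous.\<close>

lemma Theta_nonneg: "0 \<le> \<Theta>"
  using sqrt_energy_le_Theta[of 0] sigma
  by (meson energy_nonneg add_nonneg_nonneg less_imp_le not_less_zero order_trans real_sqrt_ge_zero)

lemma energy_le_power2_Theta:
  assumes "\<And>k. k < K \<Longrightarrow> sel k \<in> {1..d}"
  shows "energy sel K \<le> \<Theta>\<^sup>2"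
  using sqrt_le_D[OF sqrt_energy_le_Theta[of K sel]] assms sigma by fastforce

end

context badag
begin

subsection \<open>Deterministic selection rules\<close>

text \<open>The selected block is the largest of \<open>d\<close>, so it carries at least the
  fraction \<open>1 / d\<close> of the squared norm.\<close>

lemma gauss_southwell_mean:
  assumes gs: "gauss_southwell d b (v sel) sel"
  shows "1 / real n * (\<Sum>j<n. norm (v sel j)) \<le> sqrt (real d) * (\<Theta> / sqrt (real n))"
proof -
  have "(norm (v sel j))\<^sup>2 \<le> real d * (norm (block_part (b (sel j)) (v sel j)))\<^sup>2" for j
  proof -
    have "norm (block_part (b l) (v sel j)) \<le> norm (block_part (b (sel j)) (v sel j))" if "l \<in> {1..d}" for l
      using gs that unfolding gauss_southwell_def by (auto intro: Max_ge)
    then have "(\<Sum>l\<in>{1..d}. (norm (block_part (b l) (v sel j)))\<^sup>2)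
        \<le> (\<Sum>l\<in>{1..d}. (norm (block_part (b (sel j)) (v sel j)))\<^sup>2)"
      by (intro sum_mono power_mono) auto
    then show ?thesis by (simp add: power2_norm_sum_block_part[OF partition, of "v sel j"])
  qed
  then have "(\<Sum>j<n. (norm (v sel j))\<^sup>2) \<le> real d * energy sel n"
    unfolding energy_def sum_distrib_left by (rule sum_mono)
  also have "\<dots> \<le> real d * \<Theta>\<^sup>2"
    using gs energy_le_power2_Theta[of n sel] by (auto simp: gauss_southwell_def intro: mult_left_mono)
  also have "\<dots> = (sqrt (real d) * \<Theta>)\<^sup>2"
    by (simp add: power_mult_distrib)
  finally show ?thesis
    using mean_le_of_sum_squares_le[of "\<lambda>j. norm (v sel j)"] Theta_nonneg by simp
qed

lemma cyclic_selection_block: "m < d \<Longrightarrow> cyclic_selection d (t * d + m) = Suc m"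
  by (simp add: cyclic_selection_def)

lemma cyclic_selection_range: "cyclic_selection d k \<in> {1..d}"
  using d_pos by (simp add: cyclic_selection_def Suc_leI)

text \<open>The steps of one cycle live in distinct blocks, so the squared distance to the start of the
  cycle is the sum of the squared step lengths, and block \<open>m + 1\<close> has not moved before its turn.\<close>
lemma cycle_displacement:
  defines "sel \<equiv> cyclic_selection d"
  assumes "m \<le> d"
  shows "(norm (iter sel (t * d + m) - iter sel (t * d)))\<^sup>2
      \<le> (\<Sum>q<m. (norm (block_part (b (sel (t * d + q))) (v sel (t * d + q))))\<^sup>2)"
    and "m < l \<Longrightarrow> l \<le> d \<Longrightarrow> i \<in> b l \<Longrightarrow> iter sel (t * d + m) $ i = iter sel (t * d) $ i"
proof -
  \<comment> \<open>Stated for arbitrary \<open>m\<close>, \<open>l\<close> and \<open>i\<close>,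
    since the induction for the distance applies it at each intermediate \<open>m\<close> with
    \<open>l = Suc m\<close>.\<close>
  have fixed: "iter sel (t * d + m) $ i = iter sel (t * d) $ i"
    if "m \<le> d" "m < l" "l \<le> d" "i \<in> b l" for m l i
    using that
  proof (induction m)
    case (Suc m)
    then have "i \<notin> b (sel (t * d + m))"
      using partition disjoint_family_onD[of b "{1..d}" "Suc m" l]
      by (auto simp: sel_def cyclic_selection_block block_partition_def)
    with Suc show ?case by (simp add: iter_Suc_nth)
  qed simp
  show "m < l \<Longrightarrow> l \<le> d \<Longrightarrow> i \<in> b l \<Longrightarrow> iter sel (t * d + m) $ i = iter sel (t * d) $ i"
    using fixed \<open>m \<le> d\<close> by blast
  show "(norm (iter sel (t * d + m) - iter sel (t * d)))\<^sup>2
      \<le> (\<Sum>q<m. (norm (block_part (b (sel (t * d + q))) (v sel (t * d + q))))\<^sup>2)"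
    using \<open>m \<le> d\<close>
  proof (induction m)
    case (Suc m)
    define p where "p = iter sel (t * d + m) - iter sel (t * d)"
    define q where "q = iter sel (Suc (t * d + m)) - iter sel (t * d + m)"
    \<comment> \<open>The displacement \<open>p\<close> so far vanishes on block
      \<open>Suc m\<close>, where the step \<open>q\<close> is supported; hence they are orthogonal
      and Pythagoras applies.\<close>
    have pq: "p $ i * q $ i = 0" for i
    proof (cases "i \<in> b (sel (t * d + m))")
      case True
      then have "i \<in> b (Suc m)" using Suc.prems by (simp add: sel_def cyclic_selection_block)
      then show ?thesis using Suc.prems fixed[of m "Suc m" i] by (simp add: p_def)
    qed (simp add: q_def iter_Suc_nth)
    have "p \<bullet> q = 0" unfolding inner_vec_def inner_real_def pq by simp
    then have "(norm (p + q))\<^sup>2 = (norm p)\<^sup>2 + (norm q)\<^sup>2"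
      using norm_add_Pythagorean[of p q] by (simp add: orthogonal_def)
    moreover have "(norm q)\<^sup>2 \<le> (norm (block_part (b (sel (t * d + m))) (v sel (t * d + m))))\<^sup>2"
      unfolding q_def by (intro power_mono norm_iter_step_le) simp
    moreover have "(norm p)\<^sup>2 \<le> (\<Sum>q<m. (norm (block_part (b (sel (t * d + q))) (v sel (t * d + q))))\<^sup>2)"
      using Suc by (simp add: p_def)
    moreover have "(norm (iter sel (t * d + Suc m) - iter sel (t * d)))\<^sup>2 = (norm (p + q))\<^sup>2"
      by (simp add: p_def q_def)
    ultimately show ?case unfolding sum.lessThan_Suc by linarith
  qed simp
qed

text \<open>Block \<open>Suc m\<close> is unmoved until its turn, so there \<open>v\<close> at the
  start of the cycle and at its turn differ only through the gradient. Nonexpansiveness and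
  \<open>L\<close> bound this difference by the displacement within the cycle.\<close>

lemma cycle_power2_norm_v:
  assumes L: "\<And>x y. norm (g x - g y) \<le> L * norm (x - y)"
  defines "sel \<equiv> cyclic_selection d"
  shows "(norm (v sel (t * d)))\<^sup>2
    \<le> 2 * (1 + real d * L\<^sup>2) * (\<Sum>m<d. (norm (block_part (b (sel (t * d + m))) (v sel (t * d + m))))\<^sup>2)"
proof -
  define e where "e m = (norm (block_part (b (sel (t * d + m))) (v sel (t * d + m))))\<^sup>2" for m
  have block: "(norm (block_part (b (Suc m)) (v sel (t * d))))\<^sup>2 \<le> 2 * e m + 2 * L\<^sup>2 * sum e {..<d}"
    if m: "m < d" for m
  proof -
    define x y where "x = iter sel (t * d)" and "y = iter sel (t * d + m)"
    have "(v sel (t * d) $ i)\<^sup>2 \<le> 2 * (v sel (t * d + m) $ i)\<^sup>2 + 2 * ((g x - g y) $ i)\<^sup>2"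
      if i: "i \<in> b (Suc m)" for i
    proof -
      have xy: "y $ i = x $ i"
        using cycle_displacement(2)[of m "Suc m" i t] m i by (simp add: x_def y_def sel_def)
      define c where "c h = clip (a $ i) (u $ i) (x $ i - h)" for h
      have "\<bar>c (g x $ i) - c (g y $ i)\<bar> \<le> \<bar>g x $ i - g y $ i\<bar>"
        using clip_nonexpansive[of "a $ i" "x $ i" "u $ i" "x $ i - g x $ i" "x $ i - g y $ i"]
          iter_feasible[of sel "t * d"]
        by (simp add: c_def x_def feasible_box_def abs_minus_commute)
      then have "(c (g x $ i) - c (g y $ i))\<^sup>2 \<le> (g x $ i - g y $ i)\<^sup>2"
        by (simp add: abs_le_square_iff)
      moreover have "v sel (t * d) $ i = c (g x $ i) - x $ i" "v sel (t * d + m) $ i = c (g y $ i) - x $ i"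
        using xy by (simp_all add: v_nth c_def x_def y_def)
      \<comment> \<open>The right side exceeds the left by exactly
        \<open>(p - 2 * q)\<^sup>2\<close>.\<close>
      moreover have "p\<^sup>2 \<le> 2 * q\<^sup>2 + 2 * (p - q)\<^sup>2" for p q :: real
        using zero_le_power2[of "p - 2 * q"] by (simp add: power2_eq_square algebra_simps)
      from this[of "c (g x $ i) - x $ i" "c (g y $ i) - x $ i"]
      have "(c (g x $ i) - x $ i)\<^sup>2 \<le> 2 * (c (g y $ i) - x $ i)\<^sup>2 + 2 * (c (g x $ i) - c (g y $ i))\<^sup>2"
        by simp
      ultimately show ?thesis by simp
    qed
    then have "(\<Sum>i\<in>b (Suc m). (v sel (t * d) $ i)\<^sup>2)
        \<le> (\<Sum>i\<in>b (Suc m). 2 * (v sel (t * d + m) $ i)\<^sup>2 + 2 * ((g x - g y) $ i)\<^sup>2)"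
      by (rule sum_mono)
    also have "\<dots> = 2 * e m + 2 * (\<Sum>i\<in>b (Suc m). ((g x - g y) $ i)\<^sup>2)"
      using m by (simp add: sum.distrib sum_distrib_left e_def power2_norm_block_part sel_def
          cyclic_selection_block)
    \<comment> \<open>Passing to the full norm allows the global Lipschitz bound; as all
      \<open>d\<close> blocks pay it, the factor \<open>d\<close> in front of
      \<open>L\<^sup>2\<close> results.\<close>
    also have "(\<Sum>i\<in>b (Suc m). ((g x - g y) $ i)\<^sup>2) \<le> (norm (g x - g y))\<^sup>2"
      unfolding power2_norm_vec by (intro sum_mono2) auto
    also have "(norm (g x - g y))\<^sup>2 \<le> (L * norm (x - y))\<^sup>2"
      using L by (intro power_mono) auto
    also have "\<dots> = L\<^sup>2 * (norm (y - x))\<^sup>2"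
      by (simp add: power_mult_distrib norm_minus_commute)
    also have "(norm (y - x))\<^sup>2 \<le> sum e {..<m}"
      using cycle_displacement(1)[of m t] m by (simp add: x_def y_def e_def sel_def)
    also have "sum e {..<m} \<le> sum e {..<d}"
      using m by (intro sum_mono2) (auto simp: e_def)
    finally show ?thesis by (simp add: power2_norm_block_part mult_left_mono)
  qed
  have "(norm (v sel (t * d)))\<^sup>2 = (\<Sum>m<d. (norm (block_part (b (Suc m)) (v sel (t * d))))\<^sup>2)"
    unfolding power2_norm_sum_block_part[OF partition, of "v sel (t * d)"]
    by (rule sum.reindex_bij_witness[of _ Suc "\<lambda>l. l - 1"]) auto
  also have "\<dots> \<le> (\<Sum>m<d. 2 * e m + 2 * L\<^sup>2 * sum e {..<d})"
    by (intro sum_mono block) simp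
  also have "\<dots> = 2 * (1 + real d * L\<^sup>2) * sum e {..<d}"
    by (simp add: sum.distrib sum_distrib_left[symmetric] distrib_left distrib_right)
  finally show ?thesis unfolding e_def .
qed

lemma cyclic_mean:
  assumes L: "\<And>x y. norm (g x - g y) \<le> L * norm (x - y)"
  shows "1 / real n * (\<Sum>t<n. norm (v (cyclic_selection d) (t * d)))
    \<le> sqrt (2 * (1 + real d * ((6 + 4 * L\<^sup>2) / \<sigma>\<^sup>2))) * (\<Theta> / sqrt (real n))"
proof -
  define sel where "sel = cyclic_selection d"
  define A where "A = 2 * (1 + real d * ((6 + 4 * L\<^sup>2) / \<sigma>\<^sup>2))"
  \<comment> \<open>The cycle estimate has the constant \<open>2 * (1 + d * L\<^sup>2)\<close>;
    \<open>\<sigma> < 1\<close> lets it be enlarged to the one claimed.\<close>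
  have "L\<^sup>2 \<le> (6 + 4 * L\<^sup>2) / \<sigma>\<^sup>2"
  proof -
    have "\<sigma>\<^sup>2 \<le> 1" using sigma by (simp add: power_le_one)
    then have "L\<^sup>2 * \<sigma>\<^sup>2 \<le> L\<^sup>2" by (simp add: mult_left_le)
    also have "\<dots> \<le> 6 + 4 * L\<^sup>2" by simp
    finally show ?thesis using sigma by (simp add: pos_le_divide_eq)
  qed
  then have A: "2 * (1 + real d * L\<^sup>2) \<le> A" "0 \<le> A"
    unfolding A_def by (intro mult_left_mono add_left_mono) (auto intro!: add_nonneg_nonneg)
  have "(\<Sum>t<n. (norm (v sel (t * d)))\<^sup>2) \<le> 2 * (1 + real d * L\<^sup>2) * energy sel (n * d)"
  proof (induction n)
    case (Suc n)
    have "energy sel (Suc n * d) = energy sel (n * d) +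
        (\<Sum>m<d. (norm (block_part (b (sel (n * d + m))) (v sel (n * d + m))))\<^sup>2)"
      by (simp add: add.commute[of d] energy_add)
    then show ?case
      using Suc cycle_power2_norm_v[of L n, OF L, folded sel_def] by (simp add: distrib_left)
  qed (simp add: energy_def)
  also have "\<dots> \<le> A * \<Theta>\<^sup>2"
    using A energy_nonneg energy_le_power2_Theta[of "n * d" sel] cyclic_selection_range
    by (intro mult_mono) (auto simp: sel_def)
  also have "\<dots> = (sqrt A * \<Theta>)\<^sup>2"
    using A by (simp add: power_mult_distrib)
  finally show ?thesis
    using mean_le_of_sum_squares_le[of "\<lambda>t. norm (v sel (t * d))" n "sqrt A * \<Theta>"] Theta_nonneg A
    by (simp add: sel_def A_def)
qed

subsection \<open>Random selection\<close>

text \<open>The selection at time \<open>k\<close> acts only after \<open>v sel k\<close> has been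
  formed. Both rerouting and independence from the current draw rest on this.\<close>

lemma v_cong:
  assumes "\<And>j. j < k \<Longrightarrow> sel j = sel' j"
  shows "v sel k = v sel' k"
proof -
  have "badag_state a u g b \<sigma> x0 sel k = badag_state a u g b \<sigma> x0 sel' k"
    using assms by (induction k) simp_all
  then show ?thesis by (simp add: badag_v_def badag_iterate_def)
qed

text \<open>Rerouting the selection at time \<open>j\<close> to block \<open>l\<close> does not change \<open>v sel j\<close>.\<close>
lemma norm_block_part_v_le:
  assumes "\<And>k. k < j \<Longrightarrow> sel k \<in> {1..d}" and "l \<in> {1..d}"
  shows "norm (block_part (b l) (v sel j)) \<le> \<Theta>"
proof (rule power2_le_imp_le)
  define sel' where "sel' = sel(j := l)"
  have "v sel j = v sel' j" by (rule v_cong) (simp add: sel'_def)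
  then have "(norm (block_part (b l) (v sel j)))\<^sup>2 \<le> energy sel' (Suc j)"
    using energy_nonneg[of sel' j] by (simp add: energy_def sel'_def)
  also have "\<dots> \<le> \<Theta>\<^sup>2"
    using assms by (intro energy_le_power2_Theta) (auto simp: sel'_def less_Suc_eq)
  finally show "(norm (block_part (b l) (v sel j)))\<^sup>2 \<le> \<Theta>\<^sup>2" .
qed (rule Theta_nonneg)

end

section \<open>Range, law and independence of the uniform draws\<close>

lemma uniform_selection_AE:
  assumes unif: "uniform_selection M d \<xi>" and "1 \<le> d"
  shows "AE \<omega> in M. \<forall>k. \<xi> k \<omega> \<in> {1..d}"
proof -
  interpret prob_space M using unif by (simp add: uniform_selection_def)
  have "AE \<omega> in M. \<xi> k \<omega> \<in> {1..d}" for k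
  proof -
    have rv: "random_variable (count_space UNIV) (\<xi> k)"
      using unif by (simp add: uniform_selection_def indep_vars_def)
    have "AE l in measure_pmf (pmf_of_set {1..d}). l \<in> {1..d}"
      using \<open>1 \<le> d\<close> by (simp add: AE_measure_pmf_iff)
    moreover have "distr M (count_space UNIV) (\<xi> k) = measure_pmf (pmf_of_set {1..d})"
      using unif by (simp add: uniform_selection_def)
    ultimately have "AE l in distr M (count_space UNIV) (\<xi> k). l \<in> {1..d}"
      by (simp only:)
    then show ?thesis using rv by (subst (asm) AE_distr_iff) auto
  qed
  then show ?thesis by (simp add: AE_all_countable)
qed

lemma uniform_selection_prob:
  assumes unif: "uniform_selection M d \<xi>" and l: "l \<in> {1..d}"
  shows "(\<integral>\<omega>. indicator {l} (\<xi> k \<omega>) \<partial>M) = 1 / real d"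
proof -
  interpret prob_space M using unif by (simp add: uniform_selection_def)
  have rv: "random_variable (count_space UNIV) (\<xi> k)"
    using unif by (simp add: uniform_selection_def indep_vars_def)
  have "(\<integral>\<omega>. indicator {l} (\<xi> k \<omega>) \<partial>M) = (\<integral>x. (indicator {l} x :: real) \<partial>distr M (count_space UNIV) (\<xi> k))"
    using rv by (subst integral_distr) auto
  also have "\<dots> = pmf (pmf_of_set {1..d}) l"
    using unif by (simp add: uniform_selection_def pmf.rep_eq)
  also have "\<dots> = 1 / real d"
    using l by (subst pmf_of_set) auto
  finally show ?thesis .
qed

text \<open>\<open>h\<close> factors through the first \<open>j\<close> draws, and draws over
  disjoint index sets are independent.\<close>

lemma uniform_selection_indep:
  fixes h :: "(nat \<Rightarrow> nat) \<Rightarrow> real"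
  assumes unif: "uniform_selection M d \<xi>"
    and past: "\<And>s s'. (\<And>i. i < j \<Longrightarrow> s i = s' i) \<Longrightarrow> h s = h s'"
  shows "prob_space.indep_var M borel (\<lambda>\<omega>. h (\<lambda>i. \<xi> i \<omega>)) borel (\<lambda>\<omega>. indicator {l} (\<xi> j \<omega>) :: real)"
proof -
  interpret prob_space M using unif by (simp add: uniform_selection_def)
  let ?P = "\<lambda>A. PiM A (\<lambda>_::nat. count_space (UNIV::nat set))"
  have "indep_var (?P {..<j}) (\<lambda>\<omega>. restrict (\<lambda>i. \<xi> i \<omega>) {..<j}) (?P {j}) (\<lambda>\<omega>. restrict (\<lambda>i. \<xi> i \<omega>) {j})"
    using unif by (intro indep_var_restrict[where I = UNIV]) (auto simp: uniform_selection_def)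
  \<comment> \<open>A finite product of countable discrete spaces is discrete, so every function on
    it is measurable; \<open>h\<close> and hence \<open>g\<close> need no further
    regularity.\<close>
  moreover have "h \<in> borel_measurable (?P {..<j})"
    by (subst count_space_PiM_finite) auto
  moreover have "(\<lambda>s. indicator {l} (s j) :: real) \<in> borel_measurable (?P {j})"
    by (subst count_space_PiM_finite) auto
  ultimately have "indep_var borel (h \<circ> (\<lambda>\<omega>. restrict (\<lambda>i. \<xi> i \<omega>) {..<j}))
      borel ((\<lambda>s. indicator {l} (s j)) \<circ> (\<lambda>\<omega>. restrict (\<lambda>i. \<xi> i \<omega>) {j}))"
    by (rule indep_var_compose)
  moreover have "h (restrict (\<lambda>i. \<xi> i \<omega>) {..<j}) = h (\<lambda>i. \<xi> i \<omega>)" for \<omega>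
    by (rule past) simp
  ultimately show ?thesis by (simp add: comp_def)
qed

section \<open>Expected norm under uniform selection\<close>

context badag
begin

text \<open>The norm of block \<open>l\<close> depends on draws before \<open>j\<close> only, so the
  event that draw \<open>j\<close> equals \<open>l\<close> multiplies its expectation by
  \<open>1 / d\<close>. Summing over \<open>l\<close> recovers the norm of the selected
  block.\<close>

lemma uniform_block_expectation:
  fixes M :: "'w measure"
  assumes unif: "uniform_selection M d \<xi>"
  defines "w \<equiv> \<lambda>\<omega> j. v (\<lambda>i. \<xi> i \<omega>) j"
  shows "integrable M (\<lambda>\<omega>. norm (w \<omega> j))"
    and "integrable M (\<lambda>\<omega>. norm (block_part (b (\<xi> j \<omega>)) (w \<omega> j)))"
    and "(\<integral>\<omega>. norm (w \<omega> j) \<partial>M) \<le> real d * (\<integral>\<omega>. norm (block_part (b (\<xi> j \<omega>)) (w \<omega> j)) \<partial>M)"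
proof -
  interpret prob_space M using unif by (simp add: uniform_selection_def)
  have range: "AE \<omega> in M. \<forall>k. \<xi> k \<omega> \<in> {1..d}"
    by (rule uniform_selection_AE[OF unif d_pos])
  define F where "F l \<omega> = norm (block_part (b l) (w \<omega> j))" for l \<omega>
  define I :: "nat \<Rightarrow> 'w \<Rightarrow> real" where "I l \<omega> = indicator {l} (\<xi> j \<omega>)" for l \<omega>
  have indep: "indep_var borel (F l) borel (I l)" for l
    unfolding F_def[abs_def] I_def[abs_def] w_def
    by (rule uniform_selection_indep[OF unif, of j "\<lambda>s. norm (block_part (b l) (v s j))"])
      (rule arg_cong[of _ _ "\<lambda>x. norm (block_part (b l) x)"], rule v_cong)
  \<comment> \<open>This supplies the measurability of \<open>norm (w \<omega> j)\<close>.\<close>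
  have indep_norm: "indep_var borel (\<lambda>\<omega>. norm (w \<omega> j)) borel (I l)" for l
    unfolding I_def[abs_def] w_def
    by (rule uniform_selection_indep[OF unif, of j "\<lambda>s. norm (v s j)"])
      (rule arg_cong[of _ _ norm], rule v_cong)
  have F_bound: "AE \<omega> in M. norm (F l \<omega>) \<le> \<Theta>" if "l \<in> {1..d}" for l
    using range by eventually_elim (use that norm_block_part_v_le in \<open>simp add: F_def w_def\<close>)
  have F_int: "integrable M (F l)" if "l \<in> {1..d}" for l
    using F_bound[OF that] indep_var_rv1[OF indep] by (intro integrable_const_bound) auto
  have I_int: "integrable M (I l)" for l
    using indep_var_rv2[OF indep[of l]] by (intro integrable_const_bound[of _ 1]) (auto simp: I_def)
  have le_sum: "norm (w \<omega> j) \<le> (\<Sum>l\<in>{1..d}. F l \<omega>)" for \<omega>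
    unfolding F_def by (rule norm_le_sum_block_part[OF partition])
  have sum_int: "integrable M (\<lambda>\<omega>. \<Sum>l\<in>{1..d}. F l \<omega>)"
    using F_int by (intro Bochner_Integration.integrable_sum)
  show norm_int: "integrable M (\<lambda>\<omega>. norm (w \<omega> j))"
  proof (rule Bochner_Integration.integrable_bound[OF sum_int indep_var_rv1[OF indep_norm[of 1]]])
    have "norm (norm (w \<omega> j)) \<le> norm (\<Sum>l\<in>{1..d}. F l \<omega>)" for \<omega>
      using order_trans[OF le_sum[of \<omega>] abs_ge_self] by simp
    then show "AE \<omega> in M. norm (norm (w \<omega> j)) \<le> norm (\<Sum>l\<in>{1..d}. F l \<omega>)"
      by (rule AE_I2)
  qed
  have FI_int: "integrable M (\<lambda>\<omega>. \<Sum>l\<in>{1..d}. F l \<omega> * I l \<omega>)"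
    using F_int I_int indep by (intro Bochner_Integration.integrable_sum indep_var_integrable) auto
  \<comment> \<open>Only almost sure, since a draw may leave \<open>{1..d}\<close> on a null set;
    measurability of the left side is therefore shown separately.\<close>
  have sel_eq: "AE \<omega> in M. norm (block_part (b (\<xi> j \<omega>)) (w \<omega> j)) = (\<Sum>l\<in>{1..d}. F l \<omega> * I l \<omega>)"
    using range
  proof eventually_elim
    case (elim \<omega>)
    then show ?case
      by (simp add: F_def I_def indicator_def sum.delta if_distrib[of "\<lambda>x. _ * x"] cong: if_cong)
  qed
  have sel_meas: "(\<lambda>\<omega>. norm (block_part (b (\<xi> j \<omega>)) (w \<omega> j))) \<in> borel_measurable M"
  proof (rule measurable_compose_countable[of "\<lambda>l \<omega>. F l \<omega>" M borel "\<xi> j", unfolded F_def])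
    show "\<xi> j \<in> measurable M (count_space UNIV)"
      using unif by (simp add: uniform_selection_def indep_vars_def)
  qed (use indep_var_rv1[OF indep] in \<open>simp add: F_def[abs_def]\<close>)
  show "integrable M (\<lambda>\<omega>. norm (block_part (b (\<xi> j \<omega>)) (w \<omega> j)))"
    using FI_int by (subst integrable_cong_AE[OF sel_meas _ sel_eq]) auto
  have "(\<integral>\<omega>. norm (w \<omega> j) \<partial>M) \<le> (\<integral>\<omega>. (\<Sum>l\<in>{1..d}. F l \<omega>) \<partial>M)"
    using norm_int sum_int le_sum by (rule integral_mono)
  also have "\<dots> = (\<Sum>l\<in>{1..d}. \<integral>\<omega>. F l \<omega> \<partial>M)"
    using F_int by (intro Bochner_Integration.integral_sum)
  also have "\<dots> = (\<Sum>l\<in>{1..d}. real d * (\<integral>\<omega>. F l \<omega> * I l \<omega> \<partial>M))"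
  proof (rule sum.cong)
    fix l assume l: "l \<in> {1..d}"
    have "(\<integral>\<omega>. F l \<omega> * I l \<omega> \<partial>M) = (\<integral>\<omega>. F l \<omega> \<partial>M) * (\<integral>\<omega>. I l \<omega> \<partial>M)"
      using F_int[OF l] I_int indep by (intro indep_var_lebesgue_integral)
    also have "(\<integral>\<omega>. I l \<omega> \<partial>M) = 1 / real d"
      unfolding I_def by (rule uniform_selection_prob[OF unif l])
    finally show "(\<integral>\<omega>. F l \<omega> \<partial>M) = real d * (\<integral>\<omega>. F l \<omega> * I l \<omega> \<partial>M)"
      using d_pos by simp
  qed simp
  also have "\<dots> = real d * (\<integral>\<omega>. (\<Sum>l\<in>{1..d}. F l \<omega> * I l \<omega>) \<partial>M)"
    using F_int I_int indep
    by (subst Bochner_Integration.integral_sum) (auto simp: sum_distrib_left intro: indep_var_integrable)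
  also have "(\<integral>\<omega>. (\<Sum>l\<in>{1..d}. F l \<omega> * I l \<omega>) \<partial>M) = (\<integral>\<omega>. norm (block_part (b (\<xi> j \<omega>)) (w \<omega> j)) \<partial>M)"
    using sel_meas sel_eq FI_int by (intro integral_cong_AE) (auto elim: eventually_mono)
  finally show "(\<integral>\<omega>. norm (w \<omega> j) \<partial>M) \<le> real d * (\<integral>\<omega>. norm (block_part (b (\<xi> j \<omega>)) (w \<omega> j)) \<partial>M)" .
qed

text \<open>The expectation replaces full norms by selected ones term by term; Cauchy-Schwarz is
  then applied along almost every path, where the energy bound holds with the same
  \<open>\<Theta>\<close>.\<close>

lemma uniform_mean:
  fixes M :: "'w measure"
  assumes unif: "uniform_selection M d \<xi>"
  shows "integrable M (\<lambda>\<omega>. 1 / real n * (\<Sum>j<n. norm (v (\<lambda>i. \<xi> i \<omega>) j)))"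
    and "(\<integral>\<omega>. 1 / real n * (\<Sum>j<n. norm (v (\<lambda>i. \<xi> i \<omega>) j)) \<partial>M) \<le> real d * (\<Theta> / sqrt (real n))"
proof -
  interpret prob_space M using unif by (simp add: uniform_selection_def)
  define w where "w \<omega> j = v (\<lambda>i. \<xi> i \<omega>) j" for \<omega> j
  define e where "e \<omega> j = norm (block_part (b (\<xi> j \<omega>)) (w \<omega> j))" for \<omega> j
  note exp = uniform_block_expectation[OF unif, folded w_def, folded e_def]
  show int: "integrable M (\<lambda>\<omega>. 1 / real n * (\<Sum>j<n. norm (v (\<lambda>i. \<xi> i \<omega>) j)))"
    using exp(1) by (auto simp: w_def)
  have e_int: "integrable M (\<lambda>\<omega>. 1 / real n * (\<Sum>j<n. e \<omega> j))"
    using exp(2) by auto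
  have "(\<integral>\<omega>. 1 / real n * (\<Sum>j<n. norm (w \<omega> j)) \<partial>M) = 1 / real n * (\<Sum>j<n. \<integral>\<omega>. norm (w \<omega> j) \<partial>M)"
    using exp(1) by simp
  also have "\<dots> \<le> 1 / real n * (\<Sum>j<n. real d * (\<integral>\<omega>. e \<omega> j \<partial>M))"
    by (intro mult_left_mono sum_mono exp(3)) simp
  also have "\<dots> = real d * (\<integral>\<omega>. 1 / real n * (\<Sum>j<n. e \<omega> j) \<partial>M)"
    using exp(2) by (simp add: sum_distrib_left)
  also have "(\<integral>\<omega>. 1 / real n * (\<Sum>j<n. e \<omega> j) \<partial>M) \<le> (\<integral>\<omega>. \<Theta> / sqrt (real n) \<partial>M)"
  proof (rule integral_mono_AE[OF e_int])
    show "AE \<omega> in M. 1 / real n * (\<Sum>j<n. e \<omega> j) \<le> \<Theta> / sqrt (real n)"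
      using uniform_selection_AE[OF unif d_pos]
    proof eventually_elim
      case (elim \<omega>)
      then have "energy (\<lambda>i. \<xi> i \<omega>) n \<le> \<Theta>\<^sup>2" by (intro energy_le_power2_Theta) simp
      then show ?case
        by (intro mean_le_of_sum_squares_le Theta_nonneg) (simp add: energy_def e_def w_def)
    qed
  qed simp
  also have "(\<integral>\<omega>. \<Theta> / sqrt (real n) \<partial>M) = \<Theta> / sqrt (real n)"
    by (simp add: prob_space)
  finally show "(\<integral>\<omega>. 1 / real n * (\<Sum>j<n. norm (v (\<lambda>i. \<xi> i \<omega>) j)) \<partial>M) \<le> real d * (\<Theta> / sqrt (real n))"
    by (simp add: w_def mult_left_mono)
qed

end

theorem theorem5p2:
  fixes f :: "real ^ 'n::finite \<Rightarrow> real" and g :: "real ^ 'n \<Rightarrow> real ^ 'n"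
    and f_low \<sigma> :: real
    and d :: nat and b :: "nat \<Rightarrow> 'n set" and Lb :: "nat \<Rightarrow> real"
    and a u :: "ereal ^ 'n" and x0 :: "real ^ 'n"
  assumes gradient: "\<And>x. GDERIV f x :> g x"
    and continuous_gradient: "continuous_on UNIV g"
    and bounded_below: "\<And>x. f_low \<le> f x"
    and partition: "block_partition d b"
    and Lb_nonneg: "\<And>l. l \<in> {1..d} \<Longrightarrow> 0 \<le> Lb l"
    and block_lip: "block_lipschitz d b Lb g"
    and sigma: "0 < \<sigma>" "\<sigma> < 1"
    and start: "x0 \<in> feasible_box a u"
  defines "\<Theta> \<equiv> Theta_c CARD('n) (MAX l\<in>{1..d}. Lb l) (f x0 - f_low) \<sigma>"
  defines "v \<equiv> badag_v a u g b \<sigma> x0"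
  shows
    "(\<forall>sel. gauss_southwell d b (v sel) sel \<longrightarrow>
        (\<forall>k::nat. (1 / real (k + 1)) * (\<Sum>j=0..k. norm (v sel j))
           \<le> sqrt (real d) * (\<Theta> / sqrt (real (k + 1)))))
     \<and>
     (\<forall>L::real. 0 \<le> L \<longrightarrow> (\<forall>x y. norm (g x - g y) \<le> L * norm (x - y)) \<longrightarrow>
        (\<forall>T::nat. (1 / real (T + 1)) * (\<Sum>t=0..T. norm (v (cyclic_selection d) (t * d)))
           \<le> sqrt (2 * (1 + real d * ((6 + 4 * L\<^sup>2) / \<sigma>\<^sup>2))) * (\<Theta> / sqrt (real (T + 1)))))
     \<and>
     (\<forall>(M :: 'w measure) \<xi>. uniform_selection M d \<xi> \<longrightarrow>
        (\<forall>k::nat.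
           integrable M (\<lambda>\<omega>. (1 / real (k + 1)) * (\<Sum>j=0..k. norm (v (\<lambda>i. \<xi> i \<omega>) j))) \<and>
           (\<integral>\<omega>. (1 / real (k + 1)) * (\<Sum>j=0..k. norm (v (\<lambda>i. \<xi> i \<omega>) j)) \<partial>M)
             \<le> real d * (\<Theta> / sqrt (real (k + 1)))))"
proof -
  interpret badag f g f_low \<sigma> d b Lb a u x0
    by unfold_locales (fact assms)+
  have \<Theta>: "\<Theta> = Theta_c CARD('n) Lbar (f x0 - f_low) \<sigma>"
    unfolding \<Theta>_def Lbar_def ..
  \<comment> \<open>The lemmas sum over \<open>{..<n}\<close>; the claim is the case
    \<open>n = k + 1\<close>.\<close>
  have upto: "{0..n} = {..<n + 1}" for n :: nat by auto
  show ?thesis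
    unfolding upto \<Theta> v_def
    using gauss_southwell_mean cyclic_mean uniform_mean by blast
qed

end
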